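(* For every odd integer $n\ge 3$, the cycle $C_n$ on $n$ vertices satisfies \[ \overline{\mathrm{lcs}}(C_n)=n-1. \]
   Context: $[k]=\{1,\dots,k\}$ and $\chi(G)$ is the chromatic number of a graph $G=(V,E)$. For a proper coloring $c:V\to[\chi(G)]$, a determining set for $(G,c)$ is a set $S\subseteq V$ such that for every proper coloring $c':V\to[\chi(G)]$ of $G$, if $c'|_S=c|_S$ then $c'=c$ on all of $V$. A critical set for $(G,c)$ is a determining set for $(G,c)$ that is minimal under inclusion. Define $\mathrm{lcs}(G,c)=\max\{|X| : X \text{ is a critical set for } (G,c)\}$ and $\overline{\mathrm{lcs}}(G)=\max_c \mathrm{lcs}(G,c)$, where the maximum is over all proper colorings $c:V\to[\chi(G)]$. *)

theory Defs
  imports Main "HOL-Library.FuncSet"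
begin

text \<open>A graph is given by a vertex set \<open>V\<close> and a set \<open>E\<close> of edges \<open>{u, v}\<close>.
  A map \<open>V \<rightarrow> [k]\<close> is an element of \<open>V \<rightarrow>\<^sub>E {1..k}\<close>, so that
  equality of colorings is equality on \<open>V\<close>.\<close>

definition proper_coloring :: "'a set \<Rightarrow> 'a set set \<Rightarrow> nat \<Rightarrow> ('a \<Rightarrow> nat) \<Rightarrow> bool" where
  "proper_coloring V E k c \<longleftrightarrow>
     c \<in> V \<rightarrow>\<^sub>E {1..k} \<and> (\<forall>u\<in>V. \<forall>v\<in>V. {u, v} \<in> E \<longrightarrow> c u \<noteq> c v)"

definition chromatic_number :: "'a set \<Rightarrow> 'a set set \<Rightarrow> nat" where
  "chromatic_number V E = (LEAST k. \<exists>c. proper_coloring V E k c)"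

definition determining_set :: "'a set \<Rightarrow> 'a set set \<Rightarrow> ('a \<Rightarrow> nat) \<Rightarrow> 'a set \<Rightarrow> bool" where
  "determining_set V E c S \<longleftrightarrow>
     S \<subseteq> V \<and>
     (\<forall>c'. proper_coloring V E (chromatic_number V E) c' \<longrightarrow>
           (\<forall>v\<in>S. c' v = c v) \<longrightarrow> (\<forall>v\<in>V. c' v = c v))"

definition critical_set :: "'a set \<Rightarrow> 'a set set \<Rightarrow> ('a \<Rightarrow> nat) \<Rightarrow> 'a set \<Rightarrow> bool" where
  "critical_set V E c S \<longleftrightarrow>
     determining_set V E c S \<and> (\<forall>T. T \<subset> S \<longrightarrow> \<not> determining_set V E c T)"

text \<open>For finite \<open>V\<close>, both maxima below are over finite nonempty sets: \<open>V\<close> itself is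
  determining, hence contains a critical set.\<close>

definition lcs :: "'a set \<Rightarrow> 'a set set \<Rightarrow> ('a \<Rightarrow> nat) \<Rightarrow> nat" where
  "lcs V E c = Max {card X | X. critical_set V E c X}"

definition lcs_bar :: "'a set \<Rightarrow> 'a set set \<Rightarrow> nat" where
  "lcs_bar V E = Max {lcs V E c | c. proper_coloring V E (chromatic_number V E) c}"

text \<open>The vertices of the cycle are \<open>0, \<dots>, n - 1\<close>. The result is the simple cycle only
  for \<open>n \<ge> 3\<close>.\<close>

definition cycle_vertices :: "nat \<Rightarrow> nat set" where
  "cycle_vertices n = {0..<n}"

definition cycle_edges :: "nat \<Rightarrow> nat set set" where
  "cycle_edges n = {{i, Suc i mod n} | i. i < n}"

end

theory Submission
  imports Defs
begin

text \<open>Here \<open>\<chi> = 3\<close>. Upper bound: if all of \<open>V\<close> were critical, no single vertex could be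
  omitted, so the two neighbours of every vertex would have the same color; as \<open>n\<close> is odd, steps of
  length two connect the whole cycle, and the coloring would be constant. Lower bound: color vertex
  \<open>0\<close> with 3 and the remaining path alternately with 2 and 1. Its two neighbours force the color
  of \<open>0\<close>, while any other vertex \<open>u\<close> that is left free can be recolored with 3, its old color
  moving to \<open>0\<close> if \<open>u\<close> is adjacent to \<open>0\<close>.\<close>

lemma critical_set_subset: "critical_set V E c X \<Longrightarrow> X \<subseteq> V"
  by (simp add: critical_set_def determining_set_def)

lemma determining_set_mono:
  assumes "determining_set V E c S" "S \<subseteq> T" "T \<subseteq> V"
  shows "determining_set V E c T"
  using assms unfolding determining_set_def by (meson subsetD)

text \<open>A proper subset of \<open>S\<close> misses some \<open>u\<close> of \<open>S\<close> and
  so lies in \<open>S - {u}\<close>. Since determining sets are closed under enlargement inside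
  \<open>V\<close>, minimality need only be tested by deleting single vertices.\<close>

lemma critical_setI:
  assumes det: "determining_set V E c S"
    and "\<And>u. u \<in> S \<Longrightarrow> \<not> determining_set V E c (S - {u})"
  shows "critical_set V E c S"
proof -
  have "\<not> determining_set V E c T" if T: "T \<subset> S" for T
  proof -
    obtain u where "u \<in> S" "u \<notin> T"
      using T by blast
    then have "T \<subseteq> S - {u}"
      using T by blast
    moreover have "S - {u} \<subseteq> V"
      using det by (auto simp: determining_set_def)
    ultimately show ?thesis
      using assms(2)[OF \<open>u \<in> S\<close>] determining_set_mono by metis
  qed
  then show ?thesis
    using det by (simp add: critical_set_def)
qed

text \<open>Guarantees that the \<open>Max\<close> in \<open>lcs\<close> ranges over a nonempty set,
  without which an upper bound on its elements would say nothing about it.\<close>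

lemma critical_set_exists:
  assumes "finite V"
  shows "\<exists>X. critical_set V E c X"
proof -
  have "finite {S. determining_set V E c S}"
    by (rule finite_subset[of _ "Pow V"]) (auto simp: determining_set_def assms)
  moreover have "V \<in> {S. determining_set V E c S}"
    by (simp add: determining_set_def)
  ultimately obtain X where "X \<in> {S. determining_set V E c S}"
    and "\<forall>T\<in>{S. determining_set V E c S}. T \<subseteq> X \<longrightarrow> X = T"
    using finite_has_minimal[of "{S. determining_set V E c S}"] by blast
  then show ?thesis
    unfolding critical_set_def by blast
qed

lemma finite_critical_set_cards:
  assumes "finite V"
  shows "finite {card X | X. critical_set V E c X}"
proof (rule finite_subset)
  show "{card X | X. critical_set V E c X} \<subseteq> {..card V}"
    by (auto intro!: card_mono[OF assms] dest: critical_set_subset)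
qed simp

lemma card_le_lcs:
  assumes "finite V" "critical_set V E c X"
  shows "card X \<le> lcs V E c"
  unfolding lcs_def using assms by (intro Max_ge finite_critical_set_cards) auto

lemma lcs_le:
  assumes "finite V" "\<And>X. critical_set V E c X \<Longrightarrow> card X \<le> m"
  shows "lcs V E c \<le> m"
  unfolding lcs_def
  using assms critical_set_exists[OF assms(1), of E c]
  by (subst Max_le_iff) (auto intro: finite_critical_set_cards)

lemma lcs_bar_eqI:
  assumes le: "\<And>c. proper_coloring V E (chromatic_number V E) c \<Longrightarrow> lcs V E c \<le> m"
    and c: "proper_coloring V E (chromatic_number V E) c" "lcs V E c = m"
  shows "lcs_bar V E = m"
  unfolding lcs_bar_def
proof (rule Max_eqI)
  \<comment> \<open>Finiteness comes from the bound itself: all values lie in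
    \<open>{..m}\<close>.\<close>
  show "finite {lcs V E c | c. proper_coloring V E (chromatic_number V E) c}"
    by (rule finite_subset[of _ "{..m}"]) (auto dest: le)
qed (use le c in auto)

text \<open>An edge can be read in two orders, but inequality of colors is symmetric, so one
  condition per vertex and its successor covers both.\<close>

lemma proper_coloring_cycle_iff:
  "proper_coloring (cycle_vertices n) (cycle_edges n) k c \<longleftrightarrow>
     c \<in> {0..<n} \<rightarrow>\<^sub>E {1..k} \<and> (\<forall>i<n. c i \<noteq> c (Suc i mod n))"
proof -
  have "(\<forall>u\<in>{0..<n}. \<forall>v\<in>{0..<n}. {u, v} \<in> cycle_edges n \<longrightarrow> c u \<noteq> c v) \<longleftrightarrow>
      (\<forall>i<n. c i \<noteq> c (Suc i mod n))" (is "?L \<longleftrightarrow> ?R")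
  proof
    assume L: ?L
    show ?R
    proof (intro allI impI)
      fix i assume "i < n"
      then have "{i, Suc i mod n} \<in> cycle_edges n" "Suc i mod n < n"
        by (auto simp: cycle_edges_def)
      then show "c i \<noteq> c (Suc i mod n)"
        using L \<open>i < n\<close> by auto
    qed
  next
    assume ?R
    then show ?L
      unfolding cycle_edges_def by (fastforce simp: doubleton_eq_iff)
  qed
  then show ?thesis
    by (simp add: proper_coloring_def cycle_vertices_def)
qed

definition alternating_coloring :: "nat \<Rightarrow> nat \<Rightarrow> nat" where
  "alternating_coloring n = (\<lambda>i\<in>{0..<n}. if i = 0 then 3 else if odd i then 2 else 1)"

context
  fixes n :: nat
  assumes n: "odd n" "n \<ge> 3"
begin

lemma proper_alternating_coloring:
  "proper_coloring (cycle_vertices n) (cycle_edges n) 3 (alternating_coloring n)"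
  unfolding proper_coloring_cycle_iff
  using n by (auto simp: alternating_coloring_def mod_Suc)

text \<open>With at most two colors, the colors must alternate along the path starting at
  \<open>0\<close>. As \<open>n - 1\<close> is even, the last vertex then repeats the color of
  \<open>0\<close>, to which it is adjacent.\<close>

lemma odd_cycle_colors_ge_3:
  assumes "proper_coloring (cycle_vertices n) (cycle_edges n) k c"
  shows "k \<ge> 3"
proof (rule ccontr)
  assume "\<not> k \<ge> 3"
  have c: "c \<in> {0..<n} \<rightarrow>\<^sub>E {1..k}" and ne: "\<And>i. i < n \<Longrightarrow> c i \<noteq> c (Suc i mod n)"
    using assms by (auto simp: proper_coloring_cycle_iff)
  have two: "c i = 1 \<or> c i = 2" if "i < n" for i
    using PiE_mem[OF c, of i] that \<open>\<not> k \<ge> 3\<close> by auto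
  have "c i = c 0 \<longleftrightarrow> even i" if "i < n" for i
    using that
  proof (induction i)
    case (Suc i)
    have "c (Suc i) \<noteq> c i"
      using ne[of i] Suc.prems by simp
    then show ?case
      using Suc two[of i] two[of "Suc i"] two[of 0] by auto
  qed simp
  from this[of "n - 1"] ne[of "n - 1"] show False
    using n by auto
qed

lemma chromatic_number_odd_cycle:
  "chromatic_number (cycle_vertices n) (cycle_edges n) = 3"
  unfolding chromatic_number_def
  by (rule Least_equality) (use proper_alternating_coloring odd_cycle_colors_ge_3 in auto)

lemma not_critical_set_cycle_vertices:
  assumes c: "proper_coloring (cycle_vertices n) (cycle_edges n) 3 c"
  shows "\<not> critical_set (cycle_vertices n) (cycle_edges n) c (cycle_vertices n)"
proof
  assume crit: "critical_set (cycle_vertices n) (cycle_edges n) c (cycle_vertices n)"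
  have range: "c i \<in> {1..3}" if "i < n" for i
    using PiE_mem[of c "{0..<n}" "\<lambda>_. {1..3}" i] c that
    by (simp add: proper_coloring_cycle_iff)
  have ne: "c i \<noteq> c (Suc i mod n)" if "i < n" for i
    using c that by (simp add: proper_coloring_cycle_iff)
  \<comment> \<open>If the neighbours \<open>j\<close> and \<open>w\<close> of \<open>v\<close> had
    different colors, only one of the three colors would be left for \<open>v\<close>, so
    \<open>v\<close> could be omitted from the determining set.\<close>
  have step: "c j = c (Suc (Suc j) mod n)" if "j < n" for j
  proof (rule ccontr)
    assume diff: "c j \<noteq> c (Suc (Suc j) mod n)"
    define v where "v = Suc j mod n"
    define w where "w = Suc v mod n"
    have w: "w = Suc (Suc j) mod n"
      by (simp add: v_def w_def mod_Suc_eq)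
    have lt: "v < n" "w < n"
      using n by (auto simp: v_def w_def)
    have distinct: "j \<noteq> v" "w \<noteq> v"
      using ne[of j] ne[of v] lt that by (auto simp: v_def w_def)
    have "v \<in> cycle_vertices n"
      using lt by (simp add: cycle_vertices_def)
    then have "cycle_vertices n - {v} \<subset> cycle_vertices n"
      by blast
    then have "\<not> determining_set (cycle_vertices n) (cycle_edges n) c (cycle_vertices n - {v})"
      using crit unfolding critical_set_def by blast
    then obtain c' i where c': "proper_coloring (cycle_vertices n) (cycle_edges n) 3 c'"
      and agree': "\<forall>i\<in>cycle_vertices n - {v}. c' i = c i"
      and i: "i \<in> cycle_vertices n" "c' i \<noteq> c i"
      unfolding determining_set_def chromatic_number_odd_cycle by blast
    have agree: "c' i = c i" if "i < n" "i \<noteq> v" for i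
      using agree' that by (simp add: cycle_vertices_def)
    \<comment> \<open>The colorings differ somewhere, and \<open>v\<close> is the only vertex where
      they may.\<close>
    have "c' v \<noteq> c v"
      using agree' i by blast
    moreover have "c' v \<in> {1..3}"
      using PiE_mem[of c' "{0..<n}" "\<lambda>_. {1..3}" v] c' lt
      by (simp add: proper_coloring_cycle_iff)
    moreover have "c' j \<noteq> c' v" "c' v \<noteq> c' w"
      using c' lt that by (auto simp: proper_coloring_cycle_iff v_def w_def)
    then have "c j \<noteq> c' v" "c' v \<noteq> c w"
      using agree[of j] agree[of w] distinct lt that by auto
    moreover have "c j \<noteq> c v" "c v \<noteq> c w" "c j \<noteq> c w"
      using ne[of j] ne[of v] diff lt that by (auto simp: v_def[symmetric] w_def[symmetric] w)
    \<comment> \<open>Now \<open>c j\<close>, \<open>c w\<close>, \<open>c v\<close> and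
      \<open>c' v\<close> are four pairwise distinct elements of \<open>{1..3}\<close>.\<close>
    ultimately show False
      using range[of j] range[of v] range[of w] lt that by (simp; linarith)
  qed
  have const: "c (2 * k mod n) = c 0" for k
  proof (induction k)
    case (Suc k)
    have "c (2 * k mod n) = c (Suc (Suc (2 * k mod n)) mod n)"
      using n by (intro step) simp
    also have "Suc (Suc (2 * k mod n)) mod n = 2 * Suc k mod n"
      by (simp only: mod_Suc_Suc_eq mult_Suc_right add_2_eq_Suc)
    finally show ?case
      using Suc by simp
  qed simp
  \<comment> \<open>For odd \<open>n\<close>, this many steps of length two go once around the cycle
    and one vertex further, giving the adjacent vertices \<open>0\<close> and \<open>1\<close> the
    same color.\<close>
  have "2 * ((n + 1) div 2) mod n = 1"
    using n by (simp add: mod_Suc)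
  then have "c 1 = c 0"
    using const[of "(n + 1) div 2"] by simp
  then show False
    using ne[of 0] n by simp
qed

lemma critical_set_odd_cycle_card_le:
  assumes c: "proper_coloring (cycle_vertices n) (cycle_edges n) 3 c"
    and X: "critical_set (cycle_vertices n) (cycle_edges n) c X"
  shows "card X \<le> n - 1"
proof -
  have "X \<subset> cycle_vertices n"
    using critical_set_subset[OF X] not_critical_set_cycle_vertices[OF c] X by blast
  then have "card X < card (cycle_vertices n)"
    by (intro psubset_card_mono) (simp_all add: cycle_vertices_def)
  then show ?thesis
    by (simp add: cycle_vertices_def)
qed

lemma critical_set_alternating_coloring:
  "critical_set (cycle_vertices n) (cycle_edges n) (alternating_coloring n) {1..<n}"
proof (rule critical_setI)
  let ?c = "alternating_coloring n"
  show "determining_set (cycle_vertices n) (cycle_edges n) ?c {1..<n}"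
    unfolding determining_set_def chromatic_number_odd_cycle
  proof (intro conjI allI impI)
    show "{1..<n} \<subseteq> cycle_vertices n"
      by (auto simp: cycle_vertices_def)
  next
    fix c' assume c': "proper_coloring (cycle_vertices n) (cycle_edges n) 3 c'"
      and agree: "\<forall>v\<in>{1..<n}. c' v = ?c v"
    have ne: "c' i \<noteq> c' (Suc i mod n)" if "i < n" for i
      using c' that by (simp add: proper_coloring_cycle_iff)
    \<comment> \<open>The neighbours of \<open>0\<close> are \<open>1\<close> and
      \<open>n - 1\<close>, of opposite parity because \<open>n\<close> is odd. They therefore
      exclude both 1 and 2 at \<open>0\<close>.\<close>
    have "c' 1 = 2" "c' (n - 1) = 1"
      using agree n by (auto simp: alternating_coloring_def)
    moreover have "c' 0 \<in> {1..3}"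
      using PiE_mem[of c' "{0..<n}" "\<lambda>_. {1..3}" 0] c' n
      by (simp add: proper_coloring_cycle_iff)
    ultimately have "c' 0 = 3"
      using ne[of 0] ne[of "n - 1"] n by auto
    then show "\<forall>v\<in>cycle_vertices n. c' v = ?c v"
      using agree n by (auto simp: cycle_vertices_def alternating_coloring_def)
  qed
next
  let ?c = "alternating_coloring n"
  fix u assume u: "u \<in> {1..<n}"
  \<comment> \<open>Color 3 at \<open>u\<close> can clash only with vertex \<open>0\<close>, which
    is also free to change. If \<open>u\<close> is a neighbour of \<open>0\<close>, the two exchange
    colors: the other neighbour of \<open>0\<close> carries the other one of the colors 1 and 2, so
    no new clash arises there.\<close>
  define c' where "c' = ?c(u := 3, 0 := if u = 1 \<or> u = n - 1 then ?c u else 3)"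
  have "c' \<in> {0..<n} \<rightarrow>\<^sub>E {1..3}"
    using u n by (auto simp: c'_def alternating_coloring_def)
  moreover have "c' i \<noteq> c' (Suc i mod n)" if "i < n" for i
    using that u n by (auto simp: c'_def alternating_coloring_def mod_Suc split: if_splits)
  ultimately have "proper_coloring (cycle_vertices n) (cycle_edges n) 3 c'"
    by (simp add: proper_coloring_cycle_iff)
  moreover have "\<forall>v\<in>{1..<n} - {u}. c' v = ?c v"
    by (simp add: c'_def)
  moreover have "u \<in> cycle_vertices n" "c' u \<noteq> ?c u"
    using u by (auto simp: c'_def alternating_coloring_def cycle_vertices_def)
  ultimately show "\<not> determining_set (cycle_vertices n) (cycle_edges n) ?c ({1..<n} - {u})"
    unfolding determining_set_def chromatic_number_odd_cycle by blast
qed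

end

theorem theorem7:
  fixes n :: nat
  assumes "odd n" and "n \<ge> 3"
  shows "lcs_bar (cycle_vertices n) (cycle_edges n) = n - 1"
proof -
  have fin: "finite (cycle_vertices n)"
    by (simp add: cycle_vertices_def)
  note chi = chromatic_number_odd_cycle[OF assms]
  have le: "lcs (cycle_vertices n) (cycle_edges n) c \<le> n - 1"
    if "proper_coloring (cycle_vertices n) (cycle_edges n) 3 c" for c
    using fin critical_set_odd_cycle_card_le[OF assms that] by (rule lcs_le)
  show ?thesis
  proof (rule lcs_bar_eqI, unfold chi)
    show "proper_coloring (cycle_vertices n) (cycle_edges n) 3 (alternating_coloring n)"
      using assms by (rule proper_alternating_coloring)
    show "lcs (cycle_vertices n) (cycle_edges n) (alternating_coloring n) = n - 1"
      using le[OF proper_alternating_coloring[OF assms]]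
        card_le_lcs[OF fin critical_set_alternating_coloring[OF assms]] by simp
  qed (rule le)
qed

end
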